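(* The hypergraph $\mathcal{F}_1$ is a minimal non-metric hypergraph: it is not metric, but every sub-hypergraph of $\mathcal{F}_1$ induced by a proper subset of its vertex set is metric. Here $\mathcal{F}_1$ has vertex set $\{1,2\}\cup(\{a,b,c\}\times\{d,e\})$ (eight vertices), and its hyperedges are all $\binom{6}{3}$ three-element subsets of $\{a,b,c\}\times\{d,e\}$ together with the nine sets $\{i,(x_1,x_2),(y_1,y_2)\}$ with $i\in\{1,2\}$, $(x_1,x_2)\neq(y_1,y_2)$ in $\{a,b,c\}\times\{d,e\}$, and $x_i=y_i$.
   Context: A $3$-uniform hypergraph $(V,\mathcal{E})$ (every hyperedge has three elements) is metric if there is a metric $\mathrm{dist}$ on $V$ such that $\mathcal{E}=\{\{u,v,w\}: u,v,w \text{ pairwise distinct and } \mathrm{dist}(u,v)+\mathrm{dist}(v,w)=\mathrm{dist}(u,w)\}$. For $W\subseteq V$, the sub-hypergraph induced by $W$ is $(W,\{E\in\mathcal{E}:E\subseteq W\})$. *)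

theory Defs
  imports "HOL-Analysis.Abstract_Metric_Spaces"
begin

type_synonym 'a hypergraph = "'a set \<times> 'a set set"

abbreviation verts :: "'a hypergraph \<Rightarrow> 'a set" where
  "verts H \<equiv> fst H"

abbreviation hedges :: "'a hypergraph \<Rightarrow> 'a set set" where
  "hedges H \<equiv> snd H"

definition three_uniform :: "'a hypergraph \<Rightarrow> bool" where
  "three_uniform H \<longleftrightarrow> (\<forall>X\<in>hedges H. X \<subseteq> verts H \<and> card X = 3)"

text \<open>The distance is a total function, but only its values on the vertex set matter.\<close>

definition metric_hypergraph :: "'a hypergraph \<Rightarrow> bool" where
  "metric_hypergraph H \<longleftrightarrow>
     (\<exists>d. Metric_space (verts H) d \<and>
        hedges H = {{u, v, w} | u v w.
          u \<in> verts H \<and> v \<in> verts H \<and> w \<in> verts H \<and>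
          u \<noteq> v \<and> v \<noteq> w \<and> u \<noteq> w \<and> d u v + d v w = d u w})"

lemma metric_hypergraph_three_uniform:
  "metric_hypergraph H \<Longrightarrow> three_uniform H"
  by (auto simp: metric_hypergraph_def three_uniform_def)

definition induced_hypergraph :: "'a hypergraph \<Rightarrow> 'a set \<Rightarrow> 'a hypergraph" where
  "induced_hypergraph H W = (W, {X \<in> hedges H. X \<subseteq> W})"

definition minimal_nonmetric :: "'a hypergraph \<Rightarrow> bool" where
  "minimal_nonmetric H \<longleftrightarrow>
     \<not> metric_hypergraph H \<and>
     (\<forall>W. W \<subset> verts H \<longrightarrow> metric_hypergraph (induced_hypergraph H W))"

text \<open>The letters a, b, c, d, e. A single type for all of them lets both coordinates
  of a pair be values of one function \<open>coord\<close>.\<close>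

datatype letter = LA | LB | LC | LD | LE

definition grid :: "(letter \<times> letter) set" where
  "grid = {LA, LB, LC} \<times> {LD, LE}"

definition coord :: "nat \<Rightarrow> letter \<times> letter \<Rightarrow> letter" where
  "coord i x = (if i = 1 then fst x else snd x)"

text \<open>\<open>Inl\<close> embeds the vertices 1 and 2, \<open>Inr\<close> the six pairs.\<close>

definition F1 :: "(nat + letter \<times> letter) hypergraph" where
  "F1 =
    (Inl ` {1, 2} \<union> Inr ` grid,
     {X. X \<subseteq> Inr ` grid \<and> card X = 3} \<union>
     {{Inl i, Inr x, Inr y} | i x y.
        i \<in> {1, 2} \<and> x \<in> grid \<and> y \<in> grid \<and> x \<noteq> y \<and> coord i x = coord i y})"

lemma three_uniform_F1: "three_uniform F1"
  by (auto simp: three_uniform_def F1_def)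

lemma card_verts_F1: "card (verts F1) = 8"
  by (simp add: F1_def grid_def card_Un_disjoint card_image inj_on_def disjoint_iff
      card_cartesian_product image_iff)

end

theory Submission
  imports Defs
begin

text \<open>
  Any metric realising \<open>F1\<close> makes all triples of the six grid points collinear, hence these points
  embed isometrically into the line (Menger). For a seventh point with distance function \<open>g\<close>, which is
  1-Lipschitz, a pair \<open>x < y\<close> on the line is collinear with it iff \<open>g\<close> has slope \<open>\<plusminus>1\<close> on \<open>[x, y]\<close> or
  \<open>g x + g y = y - x\<close>; the first property passes to subintervals and the second to larger
  intervals. Comparing the matching of the grid seen by vertex 1 with the two triples seen by
  vertex 2, at the extreme points of the line, gives a contradiction. If a vertex is deleted, positions
  on the line and distance functions with the required slopes exist.
\<close>

section \<open>Metric hypergraphs as alignment of unordered triples\<close>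

text \<open>The disjuncts put \<open>v\<close>, \<open>u\<close> and \<open>w\<close> in the middle
  in turn, since a hyperedge does not record which of its vertices is the middle one.\<close>

definition aligned :: "('a \<Rightarrow> 'a \<Rightarrow> real) \<Rightarrow> 'a \<Rightarrow> 'a \<Rightarrow> 'a \<Rightarrow> bool" where
  "aligned d u v w \<longleftrightarrow> d u v + d v w = d u w \<or> d v u + d u w = d v w \<or> d u w + d w v = d u v"

lemma aligned_swap:
  assumes "Metric_space V d"
  shows "aligned d u v w \<longleftrightarrow> aligned d v u w" "aligned d u v w \<longleftrightarrow> aligned d u w v"
  using Metric_space.commute[OF assms] unfolding aligned_def by smt+

definition represents :: "'a hypergraph \<Rightarrow> ('a \<Rightarrow> 'a \<Rightarrow> real) \<Rightarrow> bool" where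
  "represents H d \<longleftrightarrow>
     (\<forall>u\<in>verts H. \<forall>v\<in>verts H. \<forall>w\<in>verts H. u \<noteq> v \<longrightarrow> v \<noteq> w \<longrightarrow> u \<noteq> w \<longrightarrow>
        ({u, v, w} \<in> hedges H \<longleftrightarrow> aligned d u v w))"

lemma representsD:
  "\<lbrakk>represents H d; u \<in> verts H; v \<in> verts H; w \<in> verts H; u \<noteq> v; v \<noteq> w; u \<noteq> w\<rbrakk>
    \<Longrightarrow> {u, v, w} \<in> hedges H \<longleftrightarrow> aligned d u v w"
  by (simp add: represents_def)

text \<open>Symmetry of alignment turns the comprehension over ordered triples into a test on any
  enumeration of a triple. Three-uniformity is stated apart because \<open>represents\<close> says
  nothing about sets other than triples of vertices.\<close>

lemma metric_hypergraph_iff: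
  "metric_hypergraph H \<longleftrightarrow> three_uniform H \<and> (\<exists>d. Metric_space (verts H) d \<and> represents H d)"
proof -
  let ?E = "\<lambda>d. {{u, v, w} | u v w. u \<in> verts H \<and> v \<in> verts H \<and> w \<in> verts H \<and>
          u \<noteq> v \<and> v \<noteq> w \<and> u \<noteq> w \<and> d u v + d v w = d u w}"
  have E: "{u, v, w} \<in> ?E d \<longleftrightarrow> aligned d u v w"
    if M: "Metric_space (verts H) d" and uvw: "u \<in> verts H" "v \<in> verts H" "w \<in> verts H"
      "u \<noteq> v" "v \<noteq> w" "u \<noteq> w" for d u v w
  proof
    assume "{u, v, w} \<in> ?E d"
    then obtain u' v' w' where e: "{u, v, w} = {u', v', w'}"
      and ne: "u' \<noteq> v'" "v' \<noteq> w'" "u' \<noteq> w'" and s: "d u' v' + d v' w' = d u' w'"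
      by blast
    from s have al: "aligned d u' v' w'"
      by (simp add: aligned_def)
    have "u' \<in> {u, v, w}" "v' \<in> {u, v, w}" "w' \<in> {u, v, w}"
      unfolding e by simp_all
    \<comment> \<open>Of the 27 assignments, those with a repetition contradict \<open>ne\<close>;
      the six permutations are settled by \<open>aligned_swap\<close> as ordered rewriting.\<close>
    then show "aligned d u v w"
      using al ne by (elim insertE emptyE) (simp_all add: aligned_swap[OF M])
  next
    assume "aligned d u v w"
    then consider "d u v + d v w = d u w" | "d v u + d u w = d v w" | "d u w + d w v = d u v"
      unfolding aligned_def by blast
    then show "{u, v, w} \<in> ?E d"
    proof cases
      case 1
      then show ?thesis using uvw by blast
    next
      case 2
      have "{u, v, w} = {v, u, w}" by blast
      then show ?thesis using uvw 2 by blast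
    next
      case 3
      have "{u, v, w} = {u, w, v}" by blast
      then show ?thesis using uvw 3 by blast
    qed
  qed
  have key: "hedges H = ?E d \<longleftrightarrow> three_uniform H \<and> represents H d" if M: "Metric_space (verts H) d" for d
  proof
    assume "hedges H = ?E d"
    then show "three_uniform H \<and> represents H d"
      unfolding represents_def
    proof (intro conjI ballI impI)
      show "three_uniform H"
        unfolding three_uniform_def \<open>hedges H = ?E d\<close> by auto
    next
      fix u v w
      assume "u \<in> verts H" "v \<in> verts H" "w \<in> verts H" "u \<noteq> v" "v \<noteq> w" "u \<noteq> w"
      from E[OF M this] show "{u, v, w} \<in> hedges H \<longleftrightarrow> aligned d u v w"
        unfolding \<open>hedges H = ?E d\<close> .
    qed
  next
    assume R: "three_uniform H \<and> represents H d"
    show "hedges H = ?E d"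
    proof (intro equalityI subsetI)
      fix X assume X: "X \<in> hedges H"
      then have "card X = 3" "X \<subseteq> verts H"
        using R by (auto simp: three_uniform_def)
      then obtain u v w where "X = {u, v, w}" "u \<noteq> v" "v \<noteq> w" "u \<noteq> w"
        by (auto simp: card_3_iff)
      then show "X \<in> ?E d"
        using X R E[OF M, of u v w] representsD[of H d u v w] \<open>X \<subseteq> verts H\<close>
        by (metis insert_subset)
    next
      fix X assume X: "X \<in> ?E d"
      then obtain u v w where "X = {u, v, w}" "u \<noteq> v" "v \<noteq> w" "u \<noteq> w"
        "u \<in> verts H" "v \<in> verts H" "w \<in> verts H"
        by blast
      then show "X \<in> hedges H"
        using X R E[OF M, of u v w] representsD[of H d u v w] by metis
    qed
  qed
  have ex: "(\<exists>d. P d \<and> R d) \<longleftrightarrow> T \<and> (\<exists>d. P d \<and> Q d)"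
    if "\<And>d. P d \<Longrightarrow> R d \<longleftrightarrow> T \<and> Q d" for P R Q :: "('a \<Rightarrow> 'a \<Rightarrow> real) \<Rightarrow> bool" and T
    using that by blast
  show ?thesis
    unfolding metric_hypergraph_def by (rule ex) (rule key)
qed

text \<open>The metric and its alignments restrict to subsets. This reduces minimality to deleting a
  single vertex.\<close>

lemma metric_hypergraph_induced:
  assumes "metric_hypergraph H" "W \<subseteq> verts H"
  shows "metric_hypergraph (induced_hypergraph H W)"
proof -
  obtain d where d: "three_uniform H" "Metric_space (verts H) d" "represents H d"
    using assms(1) unfolding metric_hypergraph_iff by blast
  have "Metric_space W d"
    using d(2) assms(2) by (rule Metric_space.subspace)
  moreover have "three_uniform (induced_hypergraph H W)"
    using d(1) by (simp add: induced_hypergraph_def three_uniform_def)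
  moreover have "represents (induced_hypergraph H W) d"
    using d(3) assms(2) by (simp add: induced_hypergraph_def represents_def subset_iff)
  ultimately show ?thesis
    unfolding metric_hypergraph_iff by (auto simp: induced_hypergraph_def)
qed

subsection \<open>Embedding into the line\<close>

text \<open>Five points are needed: a 4-cycle with opposite sides of equal length has all its triples
  aligned but does not embed.\<close>

lemma all_aligned_embeds_in_line:
  assumes M: "Metric_space S d" and S: "finite S" "5 \<le> card S"
    and al: "\<And>x y z. \<lbrakk>x \<in> S; y \<in> S; z \<in> S; x \<noteq> y; y \<noteq> z; x \<noteq> z\<rbrakk> \<Longrightarrow> aligned d x y z"
  obtains p where "\<And>x y. \<lbrakk>x \<in> S; y \<in> S\<rbrakk> \<Longrightarrow> d x y = \<bar>p x - p y\<bar>"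
proof -
  interpret Metric_space S d by fact
  \<comment> \<open>As a simp rule it would turn positivity of distances into inequality of points,
    which arithmetic cannot use.\<close>
  note mdist_pos_eq [simp del]
  let ?D = "case_prod d ` (S \<times> S)"
  have fin: "finite ?D" and ne: "?D \<noteq> {}"
    using S by auto
  \<comment> \<open>The points \<open>a\<close> and \<open>b\<close> realise the diameter. They
    become the ends of the line, and \<open>d a\<close> its coordinate.\<close>
  obtain q where "q \<in> S \<times> S" "Max ?D = case_prod d q"
    using Max_in[OF fin ne] by (rule imageE)
  then obtain a b where ab: "a \<in> S" "b \<in> S" and dab: "d a b = Max ?D"
    by (metis mem_Sigma_iff old.prod.case surj_pair)
  have max: "d x y \<le> d a b" if "x \<in> S" "y \<in> S" for x y
    using that dab Max_ge[OF fin, of "d x y"] by force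
  have pos: "0 < d x y" if "x \<in> S" "y \<in> S" "x \<noteq> y" for x y
    using that by (simp add: mdist_pos_eq)
  have "a \<noteq> b"
  proof
    assume "a = b"
    then have "d x a \<le> 0" if "x \<in> S" for x
      using max[OF that ab(1)] ab(1) by simp
    then have "S \<subseteq> {a}"
      using pos ab(1) by (metis insertI1 linorder_not_le subsetI)
    then show False
      using S card_mono[of "{a}" S] by simp
  qed
  have mid: "d a x + d x b = d a b" "0 < d a x" "0 < d x b" "d x a = d a x" "d b x = d x b"
    if "x \<in> S" "x \<noteq> a" "x \<noteq> b" for x
  proof -
    show "0 < d a x" "0 < d x b" "d x a = d a x" "d b x = d x b"
      using that ab commute by (auto simp: mdist_pos_eq)
    then show "d a x + d x b = d a b"
      using al[of a x b] that ab \<open>a \<noteq> b\<close> max[of x b] max[of a x]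
      unfolding aligned_def by auto
  qed
  \<comment> \<open>Alignment with \<open>a\<close> and with \<open>b\<close> is compared using
    \<open>d x b = d a b - d a x\<close>: a difference at either end is the difference of
    coordinates, so the only alternative is a sum at both ends.\<close>
  have tri: "d x y = \<bar>d a x - d a y\<bar> \<or> d x y = d a x + d a y \<and> d x y = d x b + d y b"
    if xy: "x \<in> S" "y \<in> S" "x \<noteq> y" "x \<noteq> a" "y \<noteq> a" "x \<noteq> b" "y \<noteq> b" for x y
  proof -
    have "d a x + d x y = d a y \<or> d a x + d a y = d x y \<or> d a y + d x y = d a x"
      using al[of a x y] mid(4)[of x] commute[of x y] xy ab unfolding aligned_def by metis
    moreover have "d x b + d x y = d y b \<or> d x b + d y b = d x y \<or> d y b + d x y = d x b"
      using al[of b x y] mid(5)[of x] mid(5)[of y] commute[of x y] commute[of b] xy ab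
      unfolding aligned_def by metis
    ultimately show ?thesis
      using mid(1-3)[OF xy(1,4,6)] mid(1-3)[OF xy(2,5,7)] pos[OF xy(1-3)] by (smt (verit))
  qed
  \<comment> \<open>A violating pair would form a 4-cycle with \<open>a\<close> and \<open>b\<close>, which no fifth point \<open>z\<close> extends.\<close>
  have "d x y = \<bar>d a x - d a y\<bar>" if xy: "x \<in> S" "y \<in> S" for x y
  proof (cases "x = y \<or> x = a \<or> y = a \<or> x = b \<or> y = b")
    case True
    then consider "x = y" | "x = a" | "y = a" | "x = b" "y \<noteq> a" "y \<noteq> b" | "y = b" "x \<noteq> a" "x \<noteq> b"
      by blast
    then show ?thesis
    proof cases
      case 1
      then show ?thesis using xy by simp
    next
      case 2
      then show ?thesis using ab by simp
    next
      case 3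
      then show ?thesis using ab commute[of x a] by simp
    next
      case 4
      then show ?thesis using mid(1,3,5)[of y] xy ab by simp
    next
      case 5
      then show ?thesis using mid(1,3)[of x] xy ab by simp
    qed
  next
    case False
    show ?thesis
    proof (rule ccontr)
      assume bad: "d x y \<noteq> \<bar>d a x - d a y\<bar>"
      have "card {a, b, x, y} \<le> 4"
        by (simp add: card_insert_if)
      then have "\<not> S \<subseteq> {a, b, x, y}"
        using S(2) card_mono[of "{a, b, x, y}" S] by auto
      then obtain z where z: "z \<in> S" "z \<noteq> a" "z \<noteq> b" "z \<noteq> x" "z \<noteq> y"
        by blast
      \<comment> \<open>Adding the two sum forms of \<open>tri\<close> gives
        \<open>2 * d x y = 2 * d a b\<close>. So \<open>x\<close> and \<open>y\<close> realise the
        diameter too, and \<open>z\<close> must lie between them.\<close>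
      have sums: "d x y = d a x + d a y" "d a x + d a y = d a b"
        using bad tri[of x y] mid(1)[of x] mid(1)[of y] False xy by auto
      have p: "0 < d x z" "0 < d z y" "d z x = d x z" "d y z = d z y" "d y x = d x y"
        using xy z commute by (auto simp: mdist_pos_eq)
      have xz: "d x z = \<bar>d a x - d a z\<bar> \<or> d x z = d a x + d a z \<and> d x z = d x b + d z b"
        and zy: "d z y = \<bar>d a z - d a y\<bar> \<or> d z y = d a z + d a y \<and> d z y = d z b + d y b"
        using tri[of x z] tri[of z y] xy z False by blast+
      have mids: "d a x + d x b = d a b" "d a y + d y b = d a b" "d a z + d z b = d a b"
        "0 < d a z" "0 < d z b" "0 < d a x" "0 < d a y"
        using mid(1-3)[of x] mid(1-3)[of y] mid(1-3)[of z] xy z False by blast+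
      have "d x z + d z y = d x y \<or> d x z + d x y = d z y \<or> d x y + d z y = d x z"
        using al[of x z y] z xy False p unfolding aligned_def by metis
      then have "d x z + d z y = d a b"
        using max[OF xy(1) z(1)] max[OF z(1) xy(2)] sums p(1,2) by linarith
      \<comment> \<open>A sum form alone already equals \<open>d a b\<close> and would leave 0 for
        the other distance. Two differences add up to less than \<open>d a b\<close>, as
        \<open>d a x\<close>, \<open>d a y\<close> and \<open>d a z\<close> lie strictly between 0
        and \<open>d a b\<close>.\<close>
      with xz zy mids sums p(1,2) show False
        by (smt (verit))
    qed
  qed
  then show ?thesis using that by blast
qed

subsection \<open>Apexes over the line\<close>

text \<open>\<open>g\<close> gives the distances from an additional point (the apex) to points at the positions \<open>p\<close>;
  \<open>R x y\<close> says that the apex is aligned with \<open>x\<close> and \<open>y\<close>.\<close>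

definition apex_profile :: "'a set \<Rightarrow> ('a \<Rightarrow> real) \<Rightarrow> ('a \<Rightarrow> real) \<Rightarrow> ('a \<Rightarrow> 'a \<Rightarrow> bool) \<Rightarrow> bool" where
  "apex_profile P p g R \<longleftrightarrow> (\<forall>x\<in>P. 0 < g x) \<and>
     (\<forall>x\<in>P. \<forall>y\<in>P. x \<noteq> y \<longrightarrow> \<bar>g x - g y\<bar> \<le> \<bar>p x - p y\<bar> \<and> \<bar>p x - p y\<bar> \<le> g x + g y \<and>
        (R x y \<longleftrightarrow> \<bar>g x - g y\<bar> = \<bar>p x - p y\<bar> \<or> \<bar>p x - p y\<bar> = g x + g y))"

text \<open>An aligned pair has either full slope, which is inherited by all points in between, or the
  apex between its two points, which is inherited by all wider pairs.\<close>

lemma apex_dichotomy: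
  assumes g: "apex_profile P p g R"
    and in_P: "x \<in> P" "y \<in> P" "z \<in> P" "x' \<in> P" "z' \<in> P"
    and "R x z" and y: "p x < p y" "p y < p z" and x'z': "p x' \<le> p x" "p z \<le> p z'"
  shows "(R x y \<and> R y z) \<or> R x' z'"
proof -
  have lip: "\<bar>g u - g v\<bar> \<le> \<bar>p u - p v\<bar>" if "u \<in> P" "v \<in> P" for u v
  proof (cases "u = v")
    case False
    then show ?thesis using g that unfolding apex_profile_def by blast
  qed simp
  have R: "R u v \<longleftrightarrow> \<bar>g u - g v\<bar> = \<bar>p u - p v\<bar> \<or> \<bar>p u - p v\<bar> = g u + g v"
    and sum: "\<bar>p u - p v\<bar> \<le> g u + g v"
    if "u \<in> P" "v \<in> P" "p u < p v" for u v
  proof -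
    have "u \<noteq> v" using that by blast
    then show "R u v \<longleftrightarrow> \<bar>g u - g v\<bar> = \<bar>p u - p v\<bar> \<or> \<bar>p u - p v\<bar> = g u + g v"
      "\<bar>p u - p v\<bar> \<le> g u + g v"
      using g that(1,2) unfolding apex_profile_def by blast+
  qed
  have "p x < p z" using y by simp
  then have "\<bar>g x - g z\<bar> = \<bar>p x - p z\<bar> \<or> \<bar>p x - p z\<bar> = g x + g z"
    using R[OF in_P(1,3)] \<open>R x z\<close> by blast
  then show ?thesis
  proof
    assume eq: "\<bar>g x - g z\<bar> = \<bar>p x - p z\<bar>"
    have "\<bar>g x - g y\<bar> = \<bar>p x - p y\<bar>" "\<bar>g y - g z\<bar> = \<bar>p y - p z\<bar>"
      using eq lip[OF in_P(1,2)] lip[OF in_P(2,3)] y by linarith+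
    then show ?thesis
      using R[OF in_P(1,2) y(1)] R[OF in_P(2,3) y(2)] by blast
  next
    assume eq: "\<bar>p x - p z\<bar> = g x + g z"
    have lt: "p x' < p z'"
      using x'z' y by linarith
    \<comment> \<open>Widening the pair raises the sum of distances by at most the added length;
      \<open>sum\<close> is the reverse bound.\<close>
    have "\<bar>p x' - p z'\<bar> = g x' + g z'"
      using eq lip[OF in_P(4,1)] lip[OF in_P(5,3)] sum[OF in_P(4,5) lt] x'z' y by linarith
    then show ?thesis
      using R[OF in_P(4,5) lt] by blast
  qed
qed

section \<open>The grid on a line and its two apexes\<close>

lemma grid_iff: "x \<in> grid \<longleftrightarrow> fst x \<in> {LA, LB, LC} \<and> snd x \<in> {LD, LE}"
  unfolding grid_def mem_Times_iff ..

lemma ex_other_fst: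
  assumes "x \<in> grid"
  obtains y z where "y \<in> grid" "z \<in> grid" "snd y = snd x" "snd z = snd x"
    "fst y \<noteq> fst x" "fst z \<noteq> fst x" "fst y \<noteq> fst z"
proof -
  have "\<exists>a\<in>{LA, LB, LC}. \<exists>b\<in>{LA, LB, LC}. a \<noteq> fst x \<and> b \<noteq> fst x \<and> a \<noteq> b"
    by (cases "fst x") simp_all
  then obtain a b where ab: "a \<in> {LA, LB, LC}" "b \<in> {LA, LB, LC}"
    "a \<noteq> fst x" "b \<noteq> fst x" "a \<noteq> b"
    by blast
  show ?thesis
    by (rule that[of "(a, snd x)" "(b, snd x)"])
      (use ab assms in \<open>simp_all only: grid_iff fst_conv snd_conv not_False_eq_True\<close>)
qed

lemma ex_partner:
  assumes "x \<in> grid"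
  obtains y where "y \<in> grid" "fst y = fst x" "snd y \<noteq> snd x"
proof -
  have "\<exists>t\<in>{LD, LE}. t \<noteq> snd x"
    by (cases "snd x") simp_all
  then obtain t where t: "t \<in> {LD, LE}" "t \<noteq> snd x"
    by blast
  show ?thesis
    by (rule that[of "(fst x, t)"]) (use t assms in \<open>simp_all only: grid_iff fst_conv snd_conv not_False_eq_True\<close>)
qed

lemma snd_grid:
  assumes "x \<in> grid" "y \<in> grid" "z \<in> grid" "snd y \<noteq> snd x" "snd z \<noteq> snd x"
  shows "snd y = snd z"
  using assms unfolding grid_iff by (metis insert_iff singletonD)

text \<open>Vertex 1 sees three pairs as classes, vertex 2 two triples. Each use of
  \<open>apex_dichotomy\<close> takes two points of one class with a point of another class in
  between, inside an outer pair from different classes, which refutes both alternatives.\<close>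

lemma no_two_apexes:
  assumes inj: "inj_on p grid"
    and g1: "apex_profile grid p g1 (\<lambda>x y. fst x = fst y)"
    and g2: "apex_profile grid p g2 (\<lambda>x y. snd x = snd y)"
  shows False
proof -
  have fin: "finite (p ` grid)" and ne: "p ` grid \<noteq> {}"
    by (auto simp: grid_def)
  obtain m where m: "m \<in> grid" "p m = Min (p ` grid)"
    using Min_in[OF fin ne] by (metis imageE)
  obtain M where M: "M \<in> grid" "p M = Max (p ` grid)"
    using Max_in[OF fin ne] by (metis imageE)
  have le: "p m \<le> p x" "p x \<le> p M" if "x \<in> grid" for x
    unfolding m(2) M(2) using that fin by simp_all
  have neq: "p x \<noteq> p y" if "x \<in> grid" "y \<in> grid" "x \<noteq> y" for x y
    using inj_onD[OF inj _ that(1,2)] that(3) by blast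
  have min: "p m < p x" if "x \<in> grid" "x \<noteq> m" for x
    using le(1)[OF that(1)] neq[OF that(1) m(1) that(2)] by simp
  have max: "p x < p M" if "x \<in> grid" "x \<noteq> M" for x
    using le(2)[OF that(1)] neq[OF that(1) M(1) that(2)] by simp
  have tot: "p x < p y \<or> p y < p x" if "x \<in> grid" "y \<in> grid" "x \<noteq> y" for x y
    using neq[OF that] by linarith
  show False
  proof (cases "snd m = snd M")
    case False
    \<comment> \<open>The two triples are separated on the line, so the pair of \<open>b\<close> has \<open>c\<close> in between.\<close>
    have sep: "p x < p y"
      if x: "x \<in> grid" "snd x = snd m" and y: "y \<in> grid" "snd y \<noteq> snd m" for x y
    proof (rule ccontr)
      assume "\<not> p x < p y"
      then have yx: "p y < p x" using tot[of x y] x y by metis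
      have my: "p m < p y" using min[of y] y by metis
      show False
        using apex_dichotomy[OF g2 m(1) y(1) x(1) m(1) M(1) x(2)[symmetric] my yx] le(1)[OF m(1)]
          le(2)[OF x(1)] y(2) False by metis
    qed
    obtain y z where yz: "y \<in> grid" "z \<in> grid" "snd y = snd m" "snd z = snd m"
      "fst y \<noteq> fst m" "fst z \<noteq> fst m" "fst y \<noteq> fst z"
      using ex_other_fst[OF m(1)] by blast
    have step: False if bc: "b \<in> grid" "c \<in> grid" "snd b = snd m" "snd c = snd m"
      "fst b \<noteq> fst m" "fst b \<noteq> fst c" "p b < p c" for b c
    proof -
      obtain b' where b': "b' \<in> grid" "fst b' = fst b" "snd b' \<noteq> snd b"
        using ex_partner[OF bc(1)] by blast
      have cb: "p c < p b'" using sep[of c b'] bc b' by simp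
      show False
        using apex_dichotomy[OF g1 bc(1,2) b'(1) m(1) b'(1) b'(2)[symmetric] bc(7) cb]
          le(1)[OF bc(1)] b'(2) bc(5,6) by simp
    qed
    show False
      using step[of y z] step[of z y] yz tot[of y z] by metis
  next
    case True
    \<comment> \<open>The partners of \<open>m\<close> and \<open>M\<close> must be their neighbours on the line, and \<open>c\<close> is left in between.\<close>
    obtain y0 z0 where "y0 \<in> grid" "z0 \<in> grid" "snd y0 = snd m" "snd z0 = snd m"
      "fst y0 \<noteq> fst m" "fst z0 \<noteq> fst m" "fst y0 \<noteq> fst z0"
      using ex_other_fst[OF m(1)] by blast
    then obtain c where c: "c \<in> grid" "snd c = snd m" "c \<noteq> m" "c \<noteq> M"
      by metis
    obtain m' where m': "m' \<in> grid" "fst m' = fst m" "snd m' \<noteq> snd m"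
      using ex_partner[OF m(1)] by blast
    obtain M' where M': "M' \<in> grid" "fst M' = fst M" "snd M' \<noteq> snd M"
      using ex_partner[OF M(1)] by blast
    have mM: "m \<noteq> M"
      using min[OF c(1,3)] max[OF c(1,4)] by force
    then have f: "fst m \<noteq> fst M" using True by (metis prod_eqI)
    have fc: "fst c \<noteq> fst m" "fst c \<noteq> fst M"
      using c True by (metis prod_eqI)+
    have mc: "p m' < p c"
    proof (rule ccontr)
      assume "\<not> p m' < p c"
      then have cm: "p c < p m'" using tot[of c m'] c m' by metis
      have mc: "p m < p c" using min[OF c(1,3)] .
      show False
        using apex_dichotomy[OF g1 m(1) c(1) m'(1) m(1) M(1) m'(2)[symmetric] mc cm]
          le(1)[OF m(1)] le(2)[OF m'(1)] f fc by simp
    qed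
    have cM: "p c < p M'"
    proof (rule ccontr)
      assume "\<not> p c < p M'"
      then have Mc: "p M' < p c" using tot[of c M'] c M' True by metis
      have cM: "p c < p M" using max[OF c(1,4)] .
      show False
        using apex_dichotomy[OF g1 M'(1) c(1) M(1) m(1) M(1) M'(2) Mc cM]
          le(1)[OF M'(1)] le(2)[OF M(1)] f fc by simp
    qed
    have mM': "snd m' = snd M'"
      using snd_grid[of m m' M'] m m' M' True by simp
    \<comment> \<open>The outer pair is \<open>m\<close>, \<open>M'\<close>, because
      \<open>m\<close> and \<open>M\<close> lie in the same triple.\<close>
    show False
      using apex_dichotomy[OF g2 m'(1) c(1) M'(1) m(1) M'(1) mM' mc cM]
          le(1)[OF m'(1)] c(2) m'(3) M'(3) True by simp
  qed
qed

subsection \<open>The hypergraph \<open>F1\<close>\<close>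

lemma hedges_F1_iff:
  "X \<in> hedges F1 \<longleftrightarrow> X \<subseteq> Inr ` grid \<and> card X = 3 \<or>
     (\<exists>i x y. X = {Inl i, Inr x, Inr y} \<and>
        i \<in> {1, 2} \<and> x \<in> grid \<and> y \<in> grid \<and> x \<noteq> y \<and> coord i x = coord i y)"
  by (simp only: F1_def snd_conv Un_iff mem_Collect_eq)

lemma F1_grid_edge:
  assumes "x \<in> grid" "y \<in> grid" "z \<in> grid" "x \<noteq> y" "y \<noteq> z" "x \<noteq> z"
  shows "{Inr x, Inr y, Inr z} \<in> hedges F1"
proof -
  have "{Inr x, Inr y, Inr z} \<subseteq> Inr ` grid"
    using assms(1-3) by blast
  moreover have "card {Inr x, Inr y, Inr z} = 3"
    using assms(4-6) by simp
  ultimately show ?thesis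
    unfolding hedges_F1_iff by (intro disjI1 conjI)
qed

lemma F1_apex_edgeE:
  assumes "X \<in> hedges F1" "Inl i \<in> X"
  obtains x y where "X = {Inl i, Inr x, Inr y}" "coord i x = coord i y"
proof -
  have "\<not> X \<subseteq> Inr ` grid"
    using assms(2) by blast
  with assms(1) obtain j x y where "X = {Inl j, Inr x, Inr y}" "coord j x = coord j y"
    unfolding hedges_F1_iff by (elim disjE exE conjE) metis+
  moreover from this assms(2) have "i = j"
    by simp
  ultimately show ?thesis
    using that by simp
qed

lemma F1_apex_edge_iff:
  assumes "i \<in> {1, 2}" "x \<in> grid" "y \<in> grid" "x \<noteq> y"
  shows "{Inl i, Inr x, Inr y} \<in> hedges F1 \<longleftrightarrow> coord i x = coord i y"
proof
  assume "{Inl i, Inr x, Inr y} \<in> hedges F1"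
  then obtain u v where e: "{Inl i, Inr x, Inr y} = {Inl i, Inr u, Inr v}"
    and uv: "coord i u = coord i v"
    by (rule F1_apex_edgeE[OF _ insertI1])
  have "Inr x \<in> {Inl i, Inr u, Inr v}" "Inr y \<in> {Inl i, Inr u, Inr v}"
    unfolding e[symmetric] by simp_all
  then show "coord i x = coord i y"
    using uv by auto
next
  assume "coord i x = coord i y"
  then show "{Inl i, Inr x, Inr y} \<in> hedges F1"
    unfolding hedges_F1_iff using assms by (intro disjI2 exI conjI) (rule refl)
qed

lemma F1_two_apexes_not_edge:
  assumes "i \<noteq> j"
  shows "{Inl i, Inl j, Inr x} \<notin> hedges F1"
proof
  assume "{Inl i, Inl j, Inr x} \<in> hedges F1"
  then obtain u v where e: "{Inl i, Inl j, Inr x} = {Inl i, Inr u, Inr v}"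
    by (rule F1_apex_edgeE[OF _ insertI1])
  have "Inl j \<in> {Inl i, Inr u, Inr v}"
    unfolding e[symmetric] by simp
  then show False
    using assms by simp
qed

lemma verts_F1: "verts F1 = Inl ` {1, 2} \<union> Inr ` grid"
  by (simp only: F1_def fst_conv)

lemma F1_not_metric: "\<not> metric_hypergraph F1"
proof
  assume "metric_hypergraph F1"
  then obtain d where M: "Metric_space (verts F1) d" and rep: "represents F1 d"
    unfolding metric_hypergraph_iff by blast
  interpret Metric_space "verts F1" d by fact
  define e where "e x y = d (Inr x) (Inr y)" for x y
  have in_V: "Inr x \<in> verts F1" if "x \<in> grid" for x
    using that unfolding verts_F1 by blast
  have in_V': "Inl i \<in> verts F1" if "i \<in> {1, 2}" for i
    using that unfolding verts_F1 by blast
  have "Metric_space grid e"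
  proof
    fix x y z
    show "0 \<le> e x y" "e x y = e y x"
      by (simp_all add: e_def commute)
    assume xyz: "x \<in> grid" "y \<in> grid"
    show "e x y = 0 \<longleftrightarrow> x = y"
      unfolding e_def using zero[OF in_V in_V, OF xyz] by simp
    assume z: "z \<in> grid"
    show "e x z \<le> e x y + e y z"
      unfolding e_def using triangle[OF in_V in_V in_V, OF xyz z] .
  qed
  moreover have "finite grid" "5 \<le> card grid"
    by (simp_all add: grid_def card_cartesian_product)
  moreover have "aligned e x y z"
    if "x \<in> grid" "y \<in> grid" "z \<in> grid" "x \<noteq> y" "y \<noteq> z" "x \<noteq> z" for x y z
    using F1_grid_edge[OF that] representsD[OF rep in_V in_V in_V, OF that(1-3)] that(4-6)
    by (simp add: aligned_def e_def)
  ultimately obtain p where p: "\<And>x y. \<lbrakk>x \<in> grid; y \<in> grid\<rbrakk> \<Longrightarrow> e x y = \<bar>p x - p y\<bar>"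
    using all_aligned_embeds_in_line by blast
  have "inj_on p grid"
  proof (rule inj_onI)
    fix x y
    assume xy: "x \<in> grid" "y \<in> grid" "p x = p y"
    then have "d (Inr x) (Inr y) = 0"
      using p[OF xy(1,2)] by (simp add: e_def)
    then show "x = y"
      using zero[OF in_V in_V, OF xy(1,2)] by simp
  qed
  moreover have prof: "apex_profile grid p (\<lambda>x. d (Inl i) (Inr x)) (\<lambda>x y. coord i x = coord i y)"
    if i: "i \<in> {1, 2}" for i
    unfolding apex_profile_def
  proof (intro conjI ballI impI)
    fix x assume "x \<in> grid"
    then show "0 < d (Inl i) (Inr x)"
      using mdist_pos_less[OF _ in_V'[OF i] in_V] by simp
  next
    fix x y assume xy: "x \<in> grid" "y \<in> grid" "x \<noteq> y"
    let ?i = "Inl i" and ?x = "Inr x" and ?y = "Inr y"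
    note V = in_V'[OF i] in_V[OF xy(1)] in_V[OF xy(2)]
    have D: "d ?x ?y = \<bar>p x - p y\<bar>" "d ?y ?x = \<bar>p x - p y\<bar>"
      using p[OF xy(1,2)] commute by (simp_all add: e_def)
    have C: "d ?x ?i = d ?i ?x" "d ?y ?i = d ?i ?y"
      by (rule commute)+
    show "\<bar>d ?i ?x - d ?i ?y\<bar> \<le> \<bar>p x - p y\<bar>"
      using triangle[OF V(1,2,3)] triangle[OF V(1,3,2)] unfolding D by linarith
    show "\<bar>p x - p y\<bar> \<le> d ?i ?x + d ?i ?y"
      using triangle[OF V(2,1,3)] unfolding D C .
    have "aligned d ?i ?x ?y \<longleftrightarrow> coord i x = coord i y"
      using representsD[OF rep V] F1_apex_edge_iff[OF i xy] xy(3) by simp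
    \<comment> \<open>The apex as middle point gives the sum, a grid point as middle point gives the
      difference.\<close>
    moreover have "aligned d ?i ?x ?y \<longleftrightarrow>
      \<bar>d ?i ?x - d ?i ?y\<bar> = \<bar>p x - p y\<bar> \<or> \<bar>p x - p y\<bar> = d ?i ?x + d ?i ?y"
      unfolding aligned_def D C by linarith
    ultimately show "coord i x = coord i y \<longleftrightarrow>
      \<bar>d ?i ?x - d ?i ?y\<bar> = \<bar>p x - p y\<bar> \<or> \<bar>p x - p y\<bar> = d ?i ?x + d ?i ?y"
      by simp
  qed
  ultimately show False
    using no_two_apexes[of p "\<lambda>x. d (Inl 1) (Inr x)" "\<lambda>x. d (Inl 2) (Inr x)"] prof[of 1] prof[of 2]
    by (simp add: coord_def)
qed

section \<open>Metrics built from a line and apexes\<close>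

text \<open>The absolute values make this function nonnegative everywhere, as \<open>Metric_space\<close> demands even
  off its carrier.\<close>

fun cone_dist :: "('b \<Rightarrow> real) \<Rightarrow> ('a \<Rightarrow> 'b \<Rightarrow> real) \<Rightarrow> real \<Rightarrow> 'a + 'b \<Rightarrow> 'a + 'b \<Rightarrow> real" where
  "cone_dist p g D (Inr x) (Inr y) = \<bar>p x - p y\<bar>"
| "cone_dist p g D (Inl i) (Inr y) = \<bar>g i y\<bar>"
| "cone_dist p g D (Inr x) (Inl i) = \<bar>g i x\<bar>"
| "cone_dist p g D (Inl i) (Inl j) = (if i = j then 0 else \<bar>D\<bar>)"

lemma cone_dist_commute: "cone_dist p g D u v = cone_dist p g D v u"
  by (cases u; cases v) (simp_all add: abs_minus_commute)

text \<open>Each bound is a triangle inequality: \<open>lip\<close> and \<open>sum\<close> for one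
  apex and two line points, \<open>apexes\<close> for two apexes and a line point. Distinct apexes
  are all at distance \<open>D\<close>, so triples of apexes are immediate.\<close>

lemma Metric_space_cone_dist:
  assumes inj: "inj_on p P" and D: "0 < D"
    and pos: "\<And>i x. \<lbrakk>i \<in> I; x \<in> P\<rbrakk> \<Longrightarrow> 0 < g i x"
    and lip: "\<And>i x y. \<lbrakk>i \<in> I; x \<in> P; y \<in> P\<rbrakk> \<Longrightarrow> \<bar>g i x - g i y\<bar> \<le> \<bar>p x - p y\<bar>"
    and sum: "\<And>i x y. \<lbrakk>i \<in> I; x \<in> P; y \<in> P\<rbrakk> \<Longrightarrow> \<bar>p x - p y\<bar> \<le> g i x + g i y"
    and apexes: "\<And>i j x. \<lbrakk>i \<in> I; j \<in> I; i \<noteq> j; x \<in> P\<rbrakk> \<Longrightarrow>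
      \<bar>g i x - g j x\<bar> \<le> D \<and> D \<le> g i x + g j x"
  shows "Metric_space (Inl ` I \<union> Inr ` P) (cone_dist p g D)"
proof
  let ?W = "Inl ` I \<union> Inr ` P" and ?d = "cone_dist p g D"
  fix u v w
  show "0 \<le> ?d u v"
    by (cases u; cases v) simp_all
  show "?d u v = ?d v u"
    by (rule cone_dist_commute)
  have in_I: "i \<in> I" if "Inl i \<in> ?W" for i
    using that by blast
  have in_P: "x \<in> P" if "Inr x \<in> ?W" for x
    using that by blast
  have abs_g: "\<bar>g i x\<bar> = g i x" if "i \<in> I" "x \<in> P" for i x
    using pos[OF that] by simp
  assume uv: "u \<in> ?W" "v \<in> ?W"
  show "?d u v = 0 \<longleftrightarrow> u = v"
  proof (cases u; cases v)
    fix i j assume "u = Inl i" "v = Inl j"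
    then show ?thesis using D by simp
  next
    fix i x assume c: "u = Inl i" "v = Inr x"
    then have "0 < g i x" using pos in_I in_P uv by blast
    then show ?thesis using c by simp
  next
    fix i x assume c: "u = Inr x" "v = Inl i"
    then have "0 < g i x" using pos in_I in_P uv by blast
    then show ?thesis using c by simp
  next
    fix x y assume c: "u = Inr x" "v = Inr y"
    then have "x \<in> P" "y \<in> P" using in_P uv by blast+
    then have "p x = p y \<longleftrightarrow> x = y" using inj inj_on_eq_iff by metis
    then show ?thesis using c by simp
  qed
  assume w: "w \<in> ?W"
  show "?d u w \<le> ?d u v + ?d v w"
  proof (cases u; cases v; cases w)
    fix i j k assume "u = Inl i" "v = Inl j" "w = Inl k"
    then show ?thesis by simp
  next
    fix i j x assume c: "u = Inl i" "v = Inl j" "w = Inr x"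
    then have m: "i \<in> I" "j \<in> I" "x \<in> P" using uv w in_I in_P by blast+
    show ?thesis
    proof (cases "i = j")
      case False
      show ?thesis
        using apexes[OF m(1,2) False m(3)] D False
        unfolding c cone_dist.simps abs_g[OF m(1,3)] abs_g[OF m(2,3)] by (simp; linarith)
    qed (simp add: c)
  next
    fix i j x assume c: "u = Inl i" "v = Inr x" "w = Inl j"
    then have m: "i \<in> I" "j \<in> I" "x \<in> P" using uv w in_I in_P by blast+
    show ?thesis
    proof (cases "i = j")
      case False
      show ?thesis
        using apexes[OF m(1,2) False m(3)] D False
        unfolding c cone_dist.simps abs_g[OF m(1,3)] abs_g[OF m(2,3)] by (simp; linarith)
    qed (simp add: c)
  next
    fix i j x assume c: "u = Inr x" "v = Inl i" "w = Inl j"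
    then have m: "i \<in> I" "j \<in> I" "x \<in> P" using uv w in_I in_P by blast+
    show ?thesis
    proof (cases "i = j")
      case False
      show ?thesis
        using apexes[OF m(1,2) False m(3)] D False
        unfolding c cone_dist.simps abs_g[OF m(1,3)] abs_g[OF m(2,3)] by (simp; linarith)
    qed (simp add: c)
  next
    fix i x y assume c: "u = Inl i" "v = Inr x" "w = Inr y"
    then have m: "i \<in> I" "x \<in> P" "y \<in> P" using uv w in_I in_P by blast+
    show ?thesis
      using lip[OF m] unfolding c cone_dist.simps abs_g[OF m(1,2)] abs_g[OF m(1,3)] by linarith
  next
    fix x i y assume c: "u = Inr x" "v = Inl i" "w = Inr y"
    then have m: "i \<in> I" "x \<in> P" "y \<in> P" using uv w in_I in_P by blast+
    show ?thesis
      using sum[OF m] unfolding c cone_dist.simps abs_g[OF m(1,2)] abs_g[OF m(1,3)] .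
  next
    fix x y i assume c: "u = Inr x" "v = Inr y" "w = Inl i"
    then have m: "i \<in> I" "x \<in> P" "y \<in> P" using uv w in_I in_P by blast+
    show ?thesis
      using lip[OF m] unfolding c cone_dist.simps abs_g[OF m(1,2)] abs_g[OF m(1,3)] by linarith
  next
    fix x y z assume "u = Inr x" "v = Inr y" "w = Inr z"
    then show ?thesis by simp
  qed
qed

text \<open>The inequalities in \<open>apexes\<close> are strict because no hyperedge contains both
  1 and 2: equality would align two apexes with a grid point.\<close>

lemma metric_induced_F1I:
  assumes I: "I \<subseteq> {1, 2}" and P: "P \<subseteq> grid" and inj: "inj_on p P" and D: "0 < D"
    and prof: "\<And>i. i \<in> I \<Longrightarrow> apex_profile P p (g i) (\<lambda>x y. coord i x = coord i y)"
    and apexes: "\<And>i j x. \<lbrakk>i \<in> I; j \<in> I; i < j; x \<in> P\<rbrakk> \<Longrightarrow>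
      \<bar>g i x - g j x\<bar> < D \<and> D < g i x + g j x"
  shows "metric_hypergraph (induced_hypergraph F1 (Inl ` I \<union> Inr ` P))"
proof -
  let ?W = "Inl ` I \<union> Inr ` P" and ?d = "cone_dist p g D"
  have pos: "0 < g i x" if "i \<in> I" "x \<in> P" for i x
    using prof[OF that(1)] that(2) unfolding apex_profile_def by blast
  then have abs_g: "\<bar>g i x\<bar> = g i x" if "i \<in> I" "x \<in> P" for i x
    using pos[OF that] by simp
  have prof': "\<bar>g i x - g i y\<bar> \<le> \<bar>p x - p y\<bar>" "\<bar>p x - p y\<bar> \<le> g i x + g i y"
    "coord i x = coord i y \<longleftrightarrow>
      \<bar>g i x - g i y\<bar> = \<bar>p x - p y\<bar> \<or> \<bar>p x - p y\<bar> = g i x + g i y"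
    if "i \<in> I" "x \<in> P" "y \<in> P" "x \<noteq> y" for i x y
    using prof[OF that(1)] that(2-4) unfolding apex_profile_def by blast+
  have two: "\<bar>g i x - g j x\<bar> < D \<and> D < g i x + g j x" if "i \<in> I" "j \<in> I" "i \<noteq> j" "x \<in> P" for i j x
  proof (cases "i < j")
    case True
    then show ?thesis using apexes that by blast
  next
    case False
    then have "\<bar>g j x - g i x\<bar> < D \<and> D < g j x + g i x" using apexes[of j i x] that by simp
    then show ?thesis by linarith
  qed
  have M: "Metric_space ?W ?d"
  proof (rule Metric_space_cone_dist[OF inj D pos])
    fix i x y assume m: "i \<in> I" "x \<in> P" "y \<in> P"
    show "\<bar>g i x - g i y\<bar> \<le> \<bar>p x - p y\<bar>" "\<bar>p x - p y\<bar> \<le> g i x + g i y"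
      using prof'(1,2)[OF m] pos[OF m(1,2)] by (cases "x = y"; simp)+
  next
    fix i j x assume "i \<in> I" "j \<in> I" "i \<noteq> j" "x \<in> P"
    from two[OF this] show "\<bar>g i x - g j x\<bar> \<le> D \<and> D \<le> g i x + g j x"
      by simp
  qed
  let ?Q = "\<lambda>u v w. {u, v, w} \<in> hedges F1 \<longleftrightarrow> aligned ?d u v w"
  \<comment> \<open>Correct representation of a triple does not depend on its order, so one order
    for each type of triple suffices.\<close>
  have swap: "?Q u v w \<longleftrightarrow> ?Q v u w" "?Q u v w \<longleftrightarrow> ?Q u w v" for u v w
  proof -
    have "{u, v, w} = {v, u, w}" "{u, v, w} = {u, w, v}" by blast+
    then show "?Q u v w \<longleftrightarrow> ?Q v u w" "?Q u v w \<longleftrightarrow> ?Q u w v"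
      using aligned_swap[OF M, of u v w] by metis+
  qed
  have Q3: "?Q (Inr x) (Inr y) (Inr z)"
    if m: "x \<in> P" "y \<in> P" "z \<in> P" and ne: "x \<noteq> y" "y \<noteq> z" "x \<noteq> z" for x y z
  proof -
    have "aligned ?d (Inr x) (Inr y) (Inr z)"
      unfolding aligned_def cone_dist.simps by linarith
    then show ?thesis
      using F1_grid_edge[OF subsetD[OF P] subsetD[OF P] subsetD[OF P], OF m ne] by blast
  qed
  have Q2: "?Q (Inl i) (Inr x) (Inr y)" if ixy: "i \<in> I" "x \<in> P" "y \<in> P" "x \<noteq> y" for i x y
  proof -
    have "aligned ?d (Inl i) (Inr x) (Inr y) \<longleftrightarrow> coord i x = coord i y"
      unfolding prof'(3)[OF ixy] aligned_def cone_dist.simps abs_g[OF ixy(1,2)] abs_g[OF ixy(1,3)]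
      by linarith
    then show ?thesis
      using F1_apex_edge_iff[OF subsetD[OF I ixy(1)] subsetD[OF P ixy(2)] subsetD[OF P ixy(3)] ixy(4)]
      by blast
  qed
  have Q1: "?Q (Inl i) (Inl j) (Inr x)" if m: "i \<in> I" "j \<in> I" "i \<noteq> j" "x \<in> P" for i j x
  proof -
    have "\<not> aligned ?d (Inl i) (Inl j) (Inr x)"
      using two[OF m] m(3) D
      unfolding aligned_def cone_dist.simps abs_g[OF m(1,4)] abs_g[OF m(2,4)] by (auto simp: abs_if split: if_splits)
    then show ?thesis
      using F1_two_apexes_not_edge[OF m(3), of x] by blast
  qed
  have "represents (induced_hypergraph F1 ?W) ?d"
    unfolding represents_def
  proof (intro ballI impI)
    fix u v w
    assume "u \<in> verts (induced_hypergraph F1 ?W)" "v \<in> verts (induced_hypergraph F1 ?W)"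
      "w \<in> verts (induced_hypergraph F1 ?W)" and ne: "u \<noteq> v" "v \<noteq> w" "u \<noteq> w"
    then have W: "u \<in> ?W" "v \<in> ?W" "w \<in> ?W"
      by (simp_all only: induced_hypergraph_def fst_conv)
    have in_I: "i \<in> I" if "Inl i \<in> ?W" for i
      using that by blast
    have in_P: "x \<in> P" if "Inr x \<in> ?W" for x
      using that by blast
    have "?Q u v w"
    proof (cases u; cases v; cases w)
      fix i j k assume c: "u = Inl i" "v = Inl j" "w = Inl k"
      then have "i \<in> I" "j \<in> I" "k \<in> I" using W in_I by blast+
      then have "i \<in> {1, 2}" "j \<in> {1, 2}" "k \<in> {1, 2}" using I by blast+
      moreover have "i \<noteq> j" "j \<noteq> k" "i \<noteq> k" using c ne by blast+
      ultimately show ?thesis by (elim insertE emptyE) simp_all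
    next
      fix i j x assume c: "u = Inl i" "v = Inl j" "w = Inr x"
      then have m: "i \<in> I" "j \<in> I" "i \<noteq> j" "x \<in> P" using W in_I in_P ne by blast+
      show ?thesis using Q1[OF m] unfolding c .
    next
      fix i x j assume c: "u = Inl i" "v = Inr x" "w = Inl j"
      then have m: "i \<in> I" "j \<in> I" "i \<noteq> j" "x \<in> P" using W in_I in_P ne by blast+
      show ?thesis using Q1[OF m] unfolding c swap(2)[of "Inl i" "Inl j"] .
    next
      fix x i j assume c: "u = Inr x" "v = Inl i" "w = Inl j"
      then have m: "i \<in> I" "j \<in> I" "i \<noteq> j" "x \<in> P" using W in_I in_P ne by blast+
      show ?thesis using Q1[OF m] unfolding c swap(2)[of "Inl i" "Inl j"] swap(1)[of "Inl i" "Inr x"] .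
    next
      fix i x y assume c: "u = Inl i" "v = Inr x" "w = Inr y"
      then have m: "i \<in> I" "x \<in> P" "y \<in> P" "x \<noteq> y" using W in_I in_P ne by blast+
      show ?thesis using Q2[OF m] unfolding c .
    next
      fix x i y assume c: "u = Inr x" "v = Inl i" "w = Inr y"
      then have m: "i \<in> I" "x \<in> P" "y \<in> P" "x \<noteq> y" using W in_I in_P ne by blast+
      show ?thesis using Q2[OF m] unfolding c swap(1)[of "Inl i" "Inr x"] .
    next
      fix x y i assume c: "u = Inr x" "v = Inr y" "w = Inl i"
      then have m: "i \<in> I" "x \<in> P" "y \<in> P" "x \<noteq> y" using W in_I in_P ne by blast+
      show ?thesis using Q2[OF m] unfolding c swap(1)[of "Inl i" "Inr x"] swap(2)[of "Inr x" "Inl i"] .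
    next
      fix x y z assume c: "u = Inr x" "v = Inr y" "w = Inr z"
      then have m: "x \<in> P" "y \<in> P" "z \<in> P" "x \<noteq> y" "y \<noteq> z" "x \<noteq> z" using W in_P ne by blast+
      show ?thesis using Q3[OF m] unfolding c .
    qed
    moreover have "{u, v, w} \<subseteq> ?W"
      using W by blast
    ultimately show "{u, v, w} \<in> hedges (induced_hypergraph F1 ?W) \<longleftrightarrow> aligned ?d u v w"
      unfolding induced_hypergraph_def snd_conv mem_Collect_eq by blast
  qed
  moreover have "three_uniform (induced_hypergraph F1 ?W)"
    using three_uniform_F1 unfolding three_uniform_def induced_hypergraph_def by simp
  moreover have "Metric_space (verts (induced_hypergraph F1 ?W)) ?d"
    using M unfolding induced_hypergraph_def fst_conv .
  ultimately show ?thesis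
    unfolding metric_hypergraph_iff by blast
qed

subsection \<open>Deleting a vertex\<close>

text \<open>The letters may be renamed freely, so that one construction covers the deletion of every
  grid point.\<close>

lemma grid_eq:
  assumes "{a, b, c} = {LA, LB, LC}" "{d, e} = {LD, LE}"
  shows "grid = {(a, d), (a, e), (b, d), (b, e), (c, d), (c, e)}"
  unfolding grid_def assms[symmetric] by blast

lemma metric_F1_minus_1: "metric_hypergraph (induced_hypergraph F1 (verts F1 - {Inl 1}))"
proof -
  \<comment> \<open>Line order AD, BD, CD, AE, BE, CE: steps of \<open>?g\<close> have full slope exactly inside the two triples.\<close>
  let ?n = "\<lambda>x. if fst x = LA then 0 else if fst x = LB then 1 else 2 :: real"
  let ?p = "\<lambda>x. if snd x = LD then ?n x else 3 + ?n x"
  \<comment> \<open>The offsets keep every sum of two values above all distances on the line, so the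
    apex is never between two points.\<close>
  let ?g = "\<lambda>x. if snd x = LD then 10 + ?n x else 12 - ?n x"
  note grid = grid_eq[OF refl refl]
  have "metric_hypergraph (induced_hypergraph F1 (Inl ` {2} \<union> Inr ` grid))"
  proof (rule metric_induced_F1I)
    show "inj_on ?p grid"
      unfolding grid by simp
    show "apex_profile grid ?p ?g (\<lambda>x y. coord i x = coord i y)" if "i \<in> {2}" for i
      using that unfolding apex_profile_def grid coord_def by simp
    \<comment> \<open>A default value for the distance between apexes, of which there is only one
      here.\<close>
    show "(0 :: real) < 1"
      by simp
  qed auto
  moreover have "verts F1 - {Inl 1} = Inl ` {2} \<union> Inr ` grid"
    unfolding verts_F1 by auto
  ultimately show ?thesis
    by simp
qed

lemma metric_F1_minus_2: "metric_hypergraph (induced_hypergraph F1 (verts F1 - {Inl 2}))"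
proof -
  \<comment> \<open>Line order AD, AE, BD, BE, CD, CE: \<open>?g\<close> alternates between slope 1 and slope 0.\<close>
  let ?n = "\<lambda>x. if fst x = LA then 0 else if fst x = LB then 1 else 2 :: real"
  let ?p = "\<lambda>x. if snd x = LD then 2 * ?n x else 2 * ?n x + 1"
  let ?g = "\<lambda>x. if snd x = LD then 10 + ?n x else 11 + ?n x"
  note grid = grid_eq[OF refl refl]
  have "metric_hypergraph (induced_hypergraph F1 (Inl ` {1} \<union> Inr ` grid))"
  proof (rule metric_induced_F1I)
    show "inj_on ?p grid"
      unfolding grid by simp
    show "apex_profile grid ?p ?g (\<lambda>x y. coord i x = coord i y)" if "i \<in> {1}" for i
      using that unfolding apex_profile_def grid coord_def by simp
    show "(0 :: real) < 1"
      by simp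
  qed auto
  moreover have "verts F1 - {Inl 2} = Inl ` {1} \<union> Inr ` grid"
    unfolding verts_F1 by auto
  ultimately show ?thesis
    by simp
qed

text \<open>Without \<open>(c, e)\<close>, vertex 1 keeps two pairs, and vertex 2 keeps one triple
  and one pair. Placing that pair at the ends of the line with the triple in the middle serves both
  vertices.\<close>

lemma metric_F1_minus_grid:
  assumes "z \<in> grid"
  shows "metric_hypergraph (induced_hypergraph F1 (verts F1 - {Inr z}))"
proof -
  obtain c e where z: "z = (c, e)"
    by (cases z)
  have c: "c \<in> {LA, LB, LC}" and e: "e \<in> {LD, LE}"
    using assms unfolding z grid_iff by simp_all
  have "\<exists>a b. {a, b, c} = {LA, LB, LC} \<and> a \<noteq> b \<and> b \<noteq> c \<and> a \<noteq> c"
    using c by (elim insertE emptyE) (rule exI[of _ LB] exI[of _ LA], rule exI[of _ LC] exI[of _ LB], force)+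
  then obtain a b where abc: "{a, b, c} = {LA, LB, LC}" and ne: "a \<noteq> b" "b \<noteq> c" "a \<noteq> c"
    by blast
  obtain d where de: "{d, e} = {LD, LE}" "d \<noteq> e"
    using e by (metis insertE insert_commute letter.distinct(19) singletonD)
  \<comment> \<open>Vertex 2 lies metrically between the end points (a, e) and (b, e), and its distances
    increase at full slope over the three middle points; vertex 1 has full slope only on the
    two outer steps.\<close>
  let ?P = "{(a, e), (a, d), (c, d), (b, d), (b, e)}"
  let ?p = "\<lambda>x. if x = (a, e) then 0 else if x = (a, d) then 10 else if x = (c, d) then 11
    else if x = (b, d) then 12 else 22 :: real"
  let ?g = "\<lambda>i::nat. if i = 1
    then (\<lambda>x. if x = (a, e) then 100 else if x = (b, e) then 120 else 110 :: real)
    else (\<lambda>x. if x = (a, d) then 10 else if x = (b, d) then 12 else 11)"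
  note neqs = ne ne[symmetric] de(2) de(2)[symmetric]
  have grid: "grid = insert z ?P"
    unfolding grid_eq[OF abc de(1)] z by blast
  have zP: "z \<notin> ?P"
    unfolding z using neqs by simp
  have "metric_hypergraph (induced_hypergraph F1 (Inl ` {1, 2} \<union> Inr ` ?P))"
  proof (rule metric_induced_F1I)
    show "?P \<subseteq> grid"
      unfolding grid by (rule subset_insertI)
    show "inj_on ?p ?P"
      using neqs by simp
    show "apex_profile ?P ?p (?g i) (\<lambda>x y. coord i x = coord i y)" if "i \<in> {1, 2}" for i
    proof (cases "i = 1")
      case True
      then show ?thesis
        unfolding apex_profile_def coord_def using neqs by simp
    next
      case False
      then show ?thesis
        unfolding apex_profile_def coord_def using neqs by simp
    qed
    fix i j x
    assume "i \<in> {1, 2 :: nat}" "j \<in> {1, 2}" "i < j" and x: "x \<in> ?P"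
    then have "i = 1" "j = 2"
      by auto
    \<comment> \<open>The distance 110 between the apexes fits strictly between the largest
      difference, 109 at \<open>(b, e)\<close>, and the smallest sum, 111 at
      \<open>(a, e)\<close>.\<close>
    then show "\<bar>?g i x - ?g j x\<bar> < 110 \<and> 110 < ?g i x + ?g j x"
      using x neqs by (elim insertE emptyE) simp_all
  qed simp_all
  moreover have "verts F1 - {Inr z} = Inl ` {1, 2} \<union> Inr ` ?P"
    unfolding verts_F1 grid using zP by blast
  ultimately show ?thesis
    by simp
qed

theorem theorem3:
  shows "minimal_nonmetric F1"
  unfolding minimal_nonmetric_def
proof (intro conjI allI impI)
  show "\<not> metric_hypergraph F1"
    by (rule F1_not_metric)
  fix W assume W: "W \<subset> verts F1"
  then obtain v where v: "v \<in> verts F1" "v \<notin> W"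
    by blast
  let ?H = "induced_hypergraph F1 (verts F1 - {v})"
  have "metric_hypergraph ?H"
    using v(1) metric_F1_minus_1 metric_F1_minus_2 metric_F1_minus_grid
    unfolding verts_F1 by blast
  moreover have sub: "W \<subseteq> verts F1 - {v}"
    using W v(2) by blast
  moreover have "verts ?H = verts F1 - {v}"
    unfolding induced_hypergraph_def fst_conv ..
  ultimately have "metric_hypergraph (induced_hypergraph ?H W)"
    using metric_hypergraph_induced[of ?H W] by metis
  moreover have "induced_hypergraph ?H W = induced_hypergraph F1 W"
    using sub unfolding induced_hypergraph_def by auto
  ultimately show "metric_hypergraph (induced_hypergraph F1 W)"
    by simp
qed

end
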